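(* If a graph $G$ is $P_5$-free and has an efficient dominating set, then its square $G^2$ is $P_4$-free.
   Context: All graphs are finite, undirected and simple. A vertex dominates itself and all its neighbors. A vertex set $D$ of $G$ is an efficient dominating set if every vertex of $G$ is dominated by exactly one vertex of $D$. The square of $G=(V,E)$ is the graph $G^2=(V,E^2)$ in which $uv\in E^2$ if and only if the distance between $u$ and $v$ in $G$ is $1$ or $2$. $P_k$ denotes the chordless path on $k$ vertices; $F$-free means having no induced subgraph isomorphic to $F$. *)

theory Defs
  imports Main
begin

definition graph :: "'a set \<Rightarrow> ('a \<Rightarrow> 'a \<Rightarrow> bool) \<Rightarrow> bool" where
  "graph V E \<longleftrightarrow> finite V \<and> (\<forall>u v. E u v \<longrightarrow> u \<in> V \<and> v \<in> V)
     \<and> (\<forall>u v. E u v \<longrightarrow> E v u) \<and> (\<forall>v. \<not> E v v)"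

definition dominates :: "('a \<Rightarrow> 'a \<Rightarrow> bool) \<Rightarrow> 'a \<Rightarrow> 'a \<Rightarrow> bool" where
  "dominates E d v \<longleftrightarrow> d = v \<or> E d v"

definition efficient_dominating_set :: "'a set \<Rightarrow> ('a \<Rightarrow> 'a \<Rightarrow> bool) \<Rightarrow> 'a set \<Rightarrow> bool" where
  "efficient_dominating_set V E D \<longleftrightarrow> D \<subseteq> V \<and>
     (\<forall>v\<in>V. \<exists>!d. d \<in> D \<and> dominates E d v)"

definition square :: "('a \<Rightarrow> 'a \<Rightarrow> bool) \<Rightarrow> 'a \<Rightarrow> 'a \<Rightarrow> bool" where
  "square E u v \<longleftrightarrow> u \<noteq> v \<and> (E u v \<or> (\<exists>w. E u w \<and> E w v))"

definition induced_path :: "'a set \<Rightarrow> ('a \<Rightarrow> 'a \<Rightarrow> bool) \<Rightarrow> 'a list \<Rightarrow> bool" where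
  "induced_path V E ps \<longleftrightarrow> distinct ps \<and> set ps \<subseteq> V \<and>
     (\<forall>i < length ps. \<forall>j < length ps. E (ps ! i) (ps ! j) \<longleftrightarrow> (i + 1 = j \<or> j + 1 = i))"

definition P_free :: "nat \<Rightarrow> 'a set \<Rightarrow> ('a \<Rightarrow> 'a \<Rightarrow> bool) \<Rightarrow> bool" where
  "P_free k V E \<longleftrightarrow> \<not> (\<exists>ps. length ps = k \<and> induced_path V E ps)"

end

theory Submission
  imports Defs
begin

text \<open>
  Let \<open>a, b, c, d\<close> induce a path in the square. By \<open>P\<^sub>5\<close>-freeness neither \<open>a b\<close> nor
  \<open>c d\<close> is an edge of the graph itself, and there is an edge \<open>x z\<close> with
  \<open>x\<close> adjacent to \<open>a, b\<close> and \<open>z\<close> adjacent to \<open>c, d\<close>, while \<open>b\<close> and \<open>c\<close> are either adjacent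
  or have a common neighbour \<open>y\<close>. Studying the dominators of \<open>x\<close> and \<open>z\<close> yields distinct
  vertices \<open>p, q\<close> of the efficient dominating set with \<open>p\<close> adjacent to \<open>a, b\<close> and \<open>q\<close> adjacent
  to \<open>c, d\<close>. Since no vertex is dominated by both, one of \<open>a p b c q\<close>, \<open>a p b y c\<close>, \<open>d q c y b\<close>
  is an induced \<open>P\<^sub>5\<close>.
\<close>

lemma induced_path_4_iff:
  "induced_path V E [a, b, c, d] \<longleftrightarrow>
     distinct [a, b, c, d] \<and> {a, b, c, d} \<subseteq> V \<and>
     E a b \<and> E b a \<and> E b c \<and> E c b \<and> E c d \<and> E d c \<and>
     \<not> E a c \<and> \<not> E c a \<and> \<not> E a d \<and> \<not> E d a \<and> \<not> E b d \<and> \<not> E d b \<and>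
     \<not> E a a \<and> \<not> E b b \<and> \<not> E c c \<and> \<not> E d d"
  unfolding induced_path_def
  by (simp add: numeral_eq_Suc All_less_Suc2) blast

lemma induced_path_5_iff:
  "induced_path V E [a, b, c, d, e] \<longleftrightarrow>
     distinct [a, b, c, d, e] \<and> {a, b, c, d, e} \<subseteq> V \<and>
     E a b \<and> E b a \<and> E b c \<and> E c b \<and> E c d \<and> E d c \<and> E d e \<and> E e d \<and>
     \<not> E a c \<and> \<not> E c a \<and> \<not> E a d \<and> \<not> E d a \<and> \<not> E a e \<and> \<not> E e a \<and>
     \<not> E b d \<and> \<not> E d b \<and> \<not> E b e \<and> \<not> E e b \<and> \<not> E c e \<and> \<not> E e c \<and>
     \<not> E a a \<and> \<not> E b b \<and> \<not> E c c \<and> \<not> E d d \<and> \<not> E e e"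
  unfolding induced_path_def
  by (simp add: numeral_eq_Suc All_less_Suc2) blast

locale P5_free_efficient =
  fixes V :: "'a set" and E :: "'a \<Rightarrow> 'a \<Rightarrow> bool" and D :: "'a set"
  assumes graph: "graph V E"
    and P5_free: "P_free 5 V E"
    and efficient: "efficient_dominating_set V E D"
begin

lemma sym: "E u v \<Longrightarrow> E v u"
  and irrefl: "\<not> E v v"
  and edge_in_V: "E u v \<Longrightarrow> u \<in> V"
  using graph unfolding graph_def by blast+

lemma comm: "E u v \<longleftrightarrow> E v u"
  using sym by blast

text \<open>The stated edges and non-edges already force the five vertices to be distinct.\<close>

lemma no_P5:
  assumes "E a b" "E b c" "E c d" "E d e"
    and "\<not> E a c" "\<not> E a d" "\<not> E a e" "\<not> E b d" "\<not> E b e" "\<not> E c e"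
  shows False
proof -
  have "distinct [a, b, c, d, e]"
    using assms sym irrefl by auto
  moreover have "{a, b, c, d, e} \<subseteq> V"
    using assms edge_in_V sym by blast
  ultimately have "induced_path V E [a, b, c, d, e]"
    unfolding induced_path_5_iff using assms sym irrefl by blast
  moreover have "length [a, b, c, d, e] = 5"
    by simp
  ultimately show False
    using P5_free unfolding P_free_def by blast
qed

lemma ex_dominator:
  assumes "E v w"
  shows "\<exists>p. p \<in> D \<and> dominates E p v"
  using assms efficient edge_in_V unfolding efficient_dominating_set_def by blast

lemma dominator_unique:
  assumes "p \<in> D" "q \<in> D" "dominates E p v" "dominates E q v"
  shows "p = q"
proof -
  have "v \<in> V"
    using assms efficient edge_in_V sym
    unfolding efficient_dominating_set_def dominates_def by blast
  then show ?thesis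
    using assms efficient unfolding efficient_dominating_set_def by blast
qed

lemma adjacent_dominator_unique:
  assumes "p \<in> D" "q \<in> D" "E p v" "E q v"
  shows "p = q"
  using assms dominator_unique unfolding dominates_def by blast

lemma not_adjacent_in_D:
  assumes "p \<in> D" "q \<in> D"
  shows "\<not> E p q"
  using assms dominator_unique[of p q q] irrefl unfolding dominates_def by blast

text \<open>For distinct vertices this is distance at least 3 (or no connecting path), the
  non-adjacency in the square.\<close>

definition far :: "'a \<Rightarrow> 'a \<Rightarrow> bool" where
  "far u v \<longleftrightarrow> \<not> E u v \<and> (\<forall>w. \<not> (E u w \<and> E w v))"

lemma far_sym: "far u v \<Longrightarrow> far v u"
  unfolding far_def using sym by blast

lemma far_iff_not_square: "u \<noteq> v \<Longrightarrow> far u v \<longleftrightarrow> \<not> square E u v"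
  unfolding far_def square_def by blast

text \<open>As \<open>x\<close> is the only dominator of \<open>z\<close>, the dominators
  \<open>q\<close> of \<open>c\<close> and \<open>r\<close> of \<open>d\<close> both miss
  \<open>z\<close>. If they differed, \<open>q c z d r\<close> would be an induced path.\<close>

lemma common_dominator_beyond_D:
  assumes "x \<in> D" "E x z" "E z c" "E z d" "\<not> E c d" "c \<noteq> d" "\<not> dominates E x c" "\<not> dominates E x d"
  shows "\<exists>q. q \<in> D \<and> E q c \<and> E q d \<and> q \<noteq> x"
proof -
  have dom_z: "r = x" if "r \<in> D" "dominates E r z" for r
    using dominator_unique[of r x z] that assms(1,2) by (simp add: dominates_def)
  have *: "\<exists>q\<in>D. E q v \<and> \<not> E q z" if v: "E z v" "\<not> dominates E x v" for v
  proof -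
    obtain q where q: "q \<in> D" "dominates E q v"
      using ex_dominator[of v z] v sym by blast
    have "q \<noteq> v"
      using dom_z[of v] q v sym unfolding dominates_def by blast
    then show ?thesis
      using q that dom_z unfolding dominates_def by blast
  qed
  obtain q where q: "q \<in> D" "E q c" "\<not> E q z"
    using * assms by blast
  obtain r where r: "r \<in> D" "E r d" "\<not> E r z"
    using * assms by blast
  have "q = r"
  proof (rule ccontr)
    assume "q \<noteq> r"
    then have "\<not> E q d" "\<not> E r c" "\<not> E q r"
      using q r adjacent_dominator_unique not_adjacent_in_D by blast+
    then show False
      using no_P5[of q c z d r] q r assms sym by blast
  qed
  then show ?thesis
    using q r assms by blast
qed

text \<open>Otherwise the dominator \<open>r\<close> of \<open>s\<close> differs from
  \<open>p\<close> and hence misses \<open>x\<close> and \<open>z\<close>, so that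
  \<open>r s x z t\<close> is an induced path.\<close>

lemma shared_dominator:
  assumes "E x s" "E x z" "E z t" "far s t"
    and "p \<in> D" "E p x" "E p z"
  shows "E p s \<or> E p t"
proof (rule ccontr)
  assume neg: "\<not> ?thesis"
  obtain r where r: "r \<in> D" "dominates E r s"
    using ex_dominator[of s x] assms sym by blast
  have "p \<noteq> s"
    using assms sym unfolding far_def by blast
  then have "r \<noteq> p"
    using r neg unfolding dominates_def by blast
  then have "\<not> E r x" "\<not> E r z"
    using adjacent_dominator_unique r assms by blast+
  moreover from this have "E r s"
    using r assms sym unfolding dominates_def by blast
  ultimately show False
    using no_P5[of r s x z t] assms sym unfolding far_def by blast
qed

text \<open>Otherwise \<open>s\<close> is dominated by a third vertex \<open>r\<close> of
  \<open>D\<close>, and \<open>r s x z q\<close> is an induced path.\<close>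

lemma distinct_dominators_aux:
  assumes "E x s" "E x z" "E z t" "far s t"
    and "p \<in> D" "q \<in> D" "E p x" "E q z" "p \<noteq> q"
  shows "dominates E p s \<or> E q s"
proof (rule ccontr)
  assume neg: "\<not> ?thesis"
  obtain r where r: "r \<in> D" "dominates E r s"
    using ex_dominator[of s x] assms sym by blast
  have "q \<noteq> s"
    using assms adjacent_dominator_unique sym unfolding far_def by blast
  then have "r \<noteq> p" "r \<noteq> q"
    using r neg unfolding dominates_def by blast+
  then have "\<not> E r x" "\<not> E r z" "\<not> E r q" "\<not> E q x"
    using adjacent_dominator_unique not_adjacent_in_D r assms by blast+
  moreover from this have "E r s"
    using r assms sym unfolding dominates_def by blast
  moreover have "\<not> E s z" "\<not> E s q"
    using assms neg sym unfolding far_def by blast+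
  ultimately show False
    using no_P5[of r s x z q] assms sym by blast
qed

text \<open>By the auxiliary lemma and its mirror image, \<open>p\<close> or \<open>q\<close>
  dominates \<open>s\<close>, and likewise \<open>t\<close>. Neither dominates both, as
  \<open>s\<close> and \<open>t\<close> are far apart; the crossed assignment makes
  \<open>q s x p t\<close> an induced path.\<close>

lemma distinct_dominators:
  assumes "E x s" "E x z" "E z t" "far s t"
    and "p \<in> D" "q \<in> D" "E p x" "E q z" "p \<noteq> q"
  shows "dominates E p s \<and> dominates E q t"
proof -
  have s: "dominates E p s \<or> E q s"
    using distinct_dominators_aux assms by blast
  have t: "dominates E q t \<or> E p t"
    using distinct_dominators_aux[of z t x s q p] assms sym far_sym by blast
  have pz: "\<not> E p z" "\<not> E q x" "\<not> E p q"
    using adjacent_dominator_unique not_adjacent_in_D assms by blast+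
  have "\<not> E q s \<or> \<not> E p t"
  proof (rule ccontr)
    assume "\<not> ?thesis"
    then have qs: "E q s" "E p t"
      by simp_all
    then have "\<not> E p s" "\<not> E q t"
      using adjacent_dominator_unique assms by blast+
    then show False
      using no_P5[of q s x p t] qs assms pz comm unfolding far_def by metis
  qed
  moreover have "\<not> (E q s \<and> dominates E q t)" "\<not> (E p t \<and> dominates E p s)"
    using assms sym unfolding far_def dominates_def by blast+
  ultimately show ?thesis
    using s t by blast
qed

text \<open>One vertex of \<open>D\<close> adjacent to \<open>a\<close>, \<open>b\<close>,
  \<open>z\<close> (or to \<open>c\<close>, \<open>d\<close>, \<open>x\<close>) suffices:
  \<open>common_dominator_beyond_D\<close> supplies the other. Only distinct dominators of
  \<open>x\<close> and \<open>z\<close> outside \<open>{x, z}\<close> need a direct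
  argument.\<close>

lemma separating_dominators:
  assumes x: "E x a" "E x b" and z: "E z c" "E z d" and xz: "E x z"
    and far: "far a c" "far a d" "far b d"
    and ab: "\<not> E a b" "a \<noteq> b" and cd: "\<not> E c d" "c \<noteq> d"
  shows "\<exists>p q. p \<in> D \<and> q \<in> D \<and> p \<noteq> q \<and> E p a \<and> E p b \<and> E q c \<and> E q d"
proof -
  have left: ?thesis if "p \<in> D" "E p a" "E p b" "E p z" for p
  proof -
    have "\<not> dominates E p c" "\<not> dominates E p d"
      using that far sym unfolding far_def dominates_def by blast+
    then show ?thesis
      using common_dominator_beyond_D[of p z c d] that z cd by blast
  qed
  have right: ?thesis if "p \<in> D" "E p c" "E p d" "E p x" for p
  proof -
    have "\<not> dominates E p a" "\<not> dominates E p b"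
      using that far sym unfolding far_def dominates_def by blast+
    then show ?thesis
      using common_dominator_beyond_D[of p x a b] that x ab by blast
  qed
  obtain p where p: "p \<in> D" "dominates E p x"
    using ex_dominator x by blast
  obtain q where q: "q \<in> D" "dominates E q z"
    using ex_dominator z by blast
  consider "x \<in> D" | "z \<in> D" | "E p x" "E q z"
    using p q unfolding dominates_def by blast
  then show ?thesis
  proof cases
    case 1
    then show ?thesis using left x xz by blast
  next
    case 2
    then show ?thesis using right z xz sym by blast
  next
    case 3
    show ?thesis
    proof (cases "p = q")
      case True
      \<comment> \<open>If \<open>E p a\<close>, then \<open>p\<close> misses \<open>d\<close> and
        so meets \<open>b\<close>; if not, \<open>p\<close> meets both \<open>c\<close> and
        \<open>d\<close>.\<close>
      have "E p a \<or> E p d" "E p b \<or> E p d" "E p a \<or> E p c"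
        using shared_dominator[OF _ xz _ _ p(1) 3(1)] x z far 3 True by blast+
      moreover have "\<not> (E p a \<and> E p d)"
        using far sym unfolding far_def by blast
      ultimately show ?thesis
        using left right p 3 True by blast
    next
      case False
      have "dominates E p a" "dominates E p b" "dominates E q c" "dominates E q d"
        using distinct_dominators[OF _ xz _ _ p(1) q(1) 3 False] x z far by blast+
      \<comment> \<open>Equality is impossible: \<open>p = a\<close> would have to dominate
        \<open>b\<close>, and similarly for the rest.\<close>
      then have "E p a" "E p b" "E q c" "E q d"
        using ab cd sym unfolding dominates_def by blast+
      then show ?thesis
        using p q False by blast
    qed
  qed
qed

lemma no_square_P4:
  assumes sq: "square E a b" "square E b c" "square E c d"
    and far: "far a c" "far a d" "far b d"
  shows False
proof -
  have ne: "a \<noteq> b" "c \<noteq> d"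
    using sq unfolding square_def by blast+
  note nonedges = far[unfolded far_def]
  have mid: "E b c \<or> (\<exists>y. E b y \<and> E y c \<and> \<not> E b c)"
    using sq unfolding square_def by blast
  \<comment> \<open>Since \<open>a\<close> and \<open>c\<close> are far apart, an edge
    \<open>a b\<close> excludes the edge \<open>b c\<close>, so a midpoint \<open>y\<close>
    exists.\<close>
  have ab: "\<not> E a b"
  proof
    assume 1: "E a b"
    then obtain y where y: "E b y" "E y c" "\<not> E b c"
      using sq nonedges unfolding square_def by blast
    show False
    proof (cases "E c d")
      case True
      then show False
        using no_P5[of a b y c d] 1 y nonedges by blast
    next
      case False
      then obtain z where z: "E c z" "E z d"
        using sq unfolding square_def by blast
      show False
      proof (cases "E y z")
        case True
        then show False
          using no_P5[of a b y z d] 1 y z nonedges sym by metis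
      next
        case c: False
        then show False
          using no_P5[of b y c z d] y z False nonedges by metis
      qed
    qed
  qed
  \<comment> \<open>The mirror image, except that \<open>ab\<close> now guarantees a midpoint
    \<open>x\<close> of \<open>a\<close> and \<open>b\<close>.\<close>
  have cd: "\<not> E c d"
  proof
    assume 1: "E c d"
    then obtain y where y: "E b y" "E y c" "\<not> E b c"
      using sq nonedges unfolding square_def by blast
    obtain x where x: "E a x" "E x b"
      using sq ab unfolding square_def by blast
    show False
    proof (cases "E x y")
      case True
      then show False
        using no_P5[of a x y c d] 1 x y nonedges by metis
    next
      case False
      then show False
        using no_P5[of a x b y c] x y ab nonedges by metis
    qed
  qed
  obtain x where x: "E a x" "E x b"
    using sq ab unfolding square_def by blast
  obtain z where z: "E c z" "E z d"
    using sq cd unfolding square_def by blast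
  \<comment> \<open>Without this edge, \<open>a x b c z\<close> or \<open>a x y z d\<close> would be
    an induced path.\<close>
  have xz: "E x z"
    using mid
  proof
    assume bc: "E b c"
    show "E x z"
      using no_P5[of a x b c z] bc x z ab nonedges sym by metis
  next
    assume "\<exists>y. E b y \<and> E y c \<and> \<not> E b c"
    then obtain y where y: "E b y" "E y c" "\<not> E b c"
      by blast
    have xy: "E x y"
      using no_P5[of a x b y c] x y ab nonedges by metis
    have yz: "E y z"
      using no_P5[of b y c z d] y z cd nonedges by metis
    show "E x z"
      using no_P5[of a x y z d] x y z xy yz nonedges sym by metis
  qed
  obtain p q where pq: "p \<in> D" "q \<in> D" "p \<noteq> q" "E p a" "E p b" "E q c" "E q d"
    using separating_dominators[of x a b z c d] x z xz far ab cd ne sym by blast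
  have "\<not> E p c" "\<not> E q b" "\<not> E q a" "\<not> E p q"
    using pq adjacent_dominator_unique not_adjacent_in_D by blast+
  note pq = pq this
  show False
    using mid
  proof
    assume bc: "E b c"
    show False
      using no_P5[of a p b c q] bc pq ab nonedges comm by metis
  next
    assume "\<exists>y. E b y \<and> E y c \<and> \<not> E b c"
    then obtain y where y: "E b y" "E y c" "\<not> E b c"
      by blast
    \<comment> \<open>Each missing edge from \<open>p\<close> or \<open>q\<close> to
      \<open>y\<close> yields an induced path, but both edges together give \<open>y\<close> two
      dominators.\<close>
    have "E p y"
      using no_P5[of a p b y c] y pq ab nonedges comm by metis
    moreover have "E q y"
      using no_P5[of d q c y b] y pq cd nonedges comm by metis
    ultimately show False
      using pq adjacent_dominator_unique by blast
  qed
qed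

end

theorem theorem3:
  fixes V :: "'a set" and E :: "'a \<Rightarrow> 'a \<Rightarrow> bool"
  assumes "graph V E"
    and "P_free 5 V E"
    and "\<exists>D. efficient_dominating_set V E D"
  shows "P_free 4 V (square E)"
proof -
  obtain D where "efficient_dominating_set V E D"
    using assms by blast
  then interpret P5_free_efficient V E D
    using assms by unfold_locales
  have False if "length ps = 4" "induced_path V (square E) ps" for ps
  proof -
    obtain a b c d where "ps = [a, b, c, d]"
      using \<open>length ps = 4\<close> by (auto simp: numeral_eq_Suc length_Suc_conv)
    with that have "induced_path V (square E) [a, b, c, d]"
      by simp
    then show False
      unfolding induced_path_4_iff
      using no_square_P4[of a b c d] far_iff_not_square by auto
  qed
  then show ?thesis
    unfolding P_free_def by blast
qed

end
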